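(* Let $B \in \mathbb{R}^{n \times n}$ be a symmetric positive definite matrix, and let $\{P_i\}_{i=1}^n$ be the sequence of lumped preconditioners constructed from $B$ (as defined in the context). Then: 1. $\Lambda(B, P_i) \subset (0,1]$ for all $i=1,\dots,n$; 2. $\lambda_k(B, P_i) \leq \lambda_k(B, P_{i+1})$ for all $k=1,\dots,n$ and any given $i=1,\dots,n-1$; 3. if $B$ is nonnegative, then $\lambda_n(B, P_i)=1$ for all $i=1,\dots,n$.
   Context: A matrix is called nonnegative if all its entries are nonnegative. For symmetric $X, Y \in \mathbb{R}^{n\times n}$ with $Y$ positive definite, the generalized eigenvalues of the pencil $(X,Y)$ are the roots $\lambda$ of $\det(X-\lambda Y)=0$, counted with multiplicity; they are all real and are numbered in ascending order, $\lambda_1(X,Y) \le \dots \le \lambda_n(X,Y)$. $\Lambda(X,Y)$ denotes the set of all generalized eigenvalues of $(X,Y)$. The lumping operator $\mathcal{L} \colon \mathbb{R}^{n \times n} \to \mathbb{R}^{n \times n}$ is defined for $X=(x_{ij})$ by $\mathcal{L}(X)=\operatorname{diag}(d_1,\dots,d_n)$ with $d_i=\sum_{j=1}^n |x_{ij}|$. Preconditioners $P_i$: for a symmetric positive definite $B=(b_{jk}) \in \mathbb{R}^{n\times n}$ and $i \in \{1,\dots,n\}$, split $B=D_i+R_i$, where $D_i$ consists of all super- and sub-diagonals of $B$ of index smaller than $i$, i.e. $(D_i)_{jk}=b_{jk}$ if $|j-k|<i$ and $(D_i)_{jk}=0$ otherwise, and $R_i = B - D_i$ is the remainder. Then $P_i=D_i+\mathcal{L}(R_i)$.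 In particular $P_1=\mathcal{L}(B)$ and $P_n=B$. *)

theory Defs
  imports "Jordan_Normal_Form.Char_Poly"
begin

text \<open>
  Matrices are elements of \<^term>\<open>carrier_mat n n\<close>, so their rows and columns are numbered from 0;
  conditions on \<open>\<bar>j - k\<bar>\<close> are unaffected by this shift. The band index of the preconditioners and
  the position of an eigenvalue in the ascending order are numbered from 1.
\<close>

definition symmetric_mat :: "real mat \<Rightarrow> bool" where
  "symmetric_mat A \<longleftrightarrow> transpose_mat A = A"

definition pos_def_mat :: "real mat \<Rightarrow> bool" where
  "pos_def_mat A \<longleftrightarrow> square_mat A \<and> (\<forall>v \<in> carrier_vec (dim_row A).
     v \<noteq> 0\<^sub>v (dim_row A) \<longrightarrow> v \<bullet> (A *\<^sub>v v) > 0)"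

definition nonneg_entries :: "real mat \<Rightarrow> bool" where
  "nonneg_entries A \<longleftrightarrow> (\<forall>j < dim_row A. \<forall>k < dim_col A. A $$ (j, k) \<ge> 0)"

text \<open>The polynomial \<open>det (X - \<lambda> Y)\<close> in the indeterminate \<open>\<lambda>\<close>.\<close>

definition pencil_poly :: "real mat \<Rightarrow> real mat \<Rightarrow> real poly" where
  "pencil_poly X Y = det (map_mat (\<lambda>a. [:a:]) X - [:0, 1:] \<cdot>\<^sub>m map_mat (\<lambda>a. [:a:]) Y)"

definition gen_eigenvalue_mset :: "real mat \<Rightarrow> real mat \<Rightarrow> real multiset" where
  "gen_eigenvalue_mset X Y = proots (pencil_poly X Y)"

text \<open>
  For symmetric \<open>X\<close> and symmetric positive definite \<open>Y\<close> the list below has length \<open>n\<close>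
  (lemma \<open>size_gen_eigenvalue_mset\<close>); it is only meant to be used for such pencils.
\<close>

definition gen_eigenvalue :: "nat \<Rightarrow> real mat \<Rightarrow> real mat \<Rightarrow> real" where
  "gen_eigenvalue k X Y = sorted_list_of_multiset (gen_eigenvalue_mset X Y) ! (k - 1)"

definition gen_spectrum :: "real mat \<Rightarrow> real mat \<Rightarrow> real set" where
  "gen_spectrum X Y = {l. det (X - l \<cdot>\<^sub>m Y) = 0}"

definition lumping :: "real mat \<Rightarrow> real mat" where
  "lumping X = mat_diag (dim_row X) (\<lambda>i. \<Sum>j<dim_col X. \<bar>X $$ (i, j)\<bar>)"

definition band_part :: "nat \<Rightarrow> real mat \<Rightarrow> real mat" where
  "band_part i B = mat (dim_row B) (dim_col B)
     (\<lambda>(j, k). if \<bar>int j - int k\<bar> < int i then B $$ (j, k) else 0)"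

definition lumped_precond :: "nat \<Rightarrow> real mat \<Rightarrow> real mat" where
  "lumped_precond i B = band_part i B + lumping (B - band_part i B)"

text \<open>
  The remaining lemmas justify the definitions above: a symmetric pencil with positive definite
  second member has \<open>n\<close> real generalized eigenvalues counted with multiplicity (so restricting to
  real roots loses nothing), and \<^const>\<open>gen_spectrum\<close> is the set of these.
\<close>

lemma pencil_poly_poly:
  assumes "X \<in> carrier_mat n n" "Y \<in> carrier_mat n n"
  shows "poly (pencil_poly X Y) l = det (X - l \<cdot>\<^sub>m Y)"
proof -
  have hom: "comm_ring_hom (\<lambda>p. poly p l)" by unfold_locales auto
  have "map_mat (\<lambda>p. poly p l) (map_mat (\<lambda>a. [:a:]) X - [:0, 1:] \<cdot>\<^sub>m map_mat (\<lambda>a. [:a:]) Y)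
      = X - l \<cdot>\<^sub>m Y"
    by (rule eq_matI) (use assms in auto)
  then show ?thesis unfolding pencil_poly_def by (metis comm_ring_hom.hom_det[OF hom])
qed

lemma pos_def_mat_inverse:
  assumes Y: "Y \<in> carrier_mat n n" and pd: "pos_def_mat Y"
  obtains Z where "Z \<in> carrier_mat n n" "Z * Y = 1\<^sub>m n" "Y * Z = 1\<^sub>m n"
proof -
  have "det Y \<noteq> 0"
  proof
    assume "det Y = 0"
    then obtain v where v: "v \<in> carrier_vec n" "v \<noteq> 0\<^sub>v n" "Y *\<^sub>v v = 0\<^sub>v n"
      using det_0_iff_vec_prod_zero_field[OF Y] by auto
    then have "v \<bullet> (Y *\<^sub>v v) > 0" using pd Y unfolding pos_def_mat_def by auto
    then show False using v by simp
  qed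
  from det_non_zero_imp_unit[OF Y this, of "()"] show ?thesis
    using that unfolding Units_def ring_mat_def by auto
qed

lemma pencil_poly_char_poly:
  assumes X: "X \<in> carrier_mat n n" and Y: "Y \<in> carrier_mat n n" and Z: "Z \<in> carrier_mat n n"
    and YZ: "Y * Z = 1\<^sub>m n"
  shows "pencil_poly X Y = Polynomial.smult ((-1) ^ n * det Y) (char_poly (Z * X))"
proof -
  interpret c: comm_ring_hom "\<lambda>a :: real. [:a:]"
    by unfold_locales (auto simp: one_pCons)
  let ?c = "map_mat (\<lambda>a :: real. [:a:])"
  have ZX: "Z * X \<in> carrier_mat n n" using X Z by auto
  have YZX: "Y * (Z * X) = X" using X Y Z YZ by (simp flip: assoc_mult_mat)
  have dims: "?c X \<in> carrier_mat n n" "?c Y \<in> carrier_mat n n"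
    "char_poly_matrix (Z * X) \<in> carrier_mat n n" using X Y ZX by auto
  have cm: "char_poly_matrix (Z * X) = [:0, 1:] \<cdot>\<^sub>m 1\<^sub>m n - ?c (Z * X)"
    by (rule eq_matI) (use Z X in \<open>auto simp: char_poly_matrix_def\<close>)
  have "?c Y * char_poly_matrix (Z * X) = ?c Y * ([:0, 1:] \<cdot>\<^sub>m 1\<^sub>m n) - ?c Y * ?c (Z * X)"
    unfolding cm by (rule mult_minus_distrib_mat[of _ n n _ n]) (use Y ZX in auto)
  also have "?c Y * ([:0, 1:] \<cdot>\<^sub>m 1\<^sub>m n) = [:0, 1:] \<cdot>\<^sub>m ?c Y"
    using mult_smult_distrib[OF dims(2) one_carrier_mat, of "[:0, 1:]"] Y by simp
  also have "?c Y * ?c (Z * X) = ?c X"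
    using c.mat_hom_mult[OF Y ZX] YZX by simp
  finally have eq: "?c Y * char_poly_matrix (Z * X) = [:0, 1:] \<cdot>\<^sub>m ?c Y - ?c X" .
  have neg: "?c X - [:0, 1:] \<cdot>\<^sub>m ?c Y = (-1) \<cdot>\<^sub>m (?c Y * char_poly_matrix (Z * X))"
    unfolding eq by (rule eq_matI) (use X Y in auto)
  have "pencil_poly X Y = (-1) ^ n * (det (?c Y) * char_poly (Z * X))"
    unfolding pencil_poly_def neg char_poly_def
    using dims det_mult[OF dims(2,3)] by (simp del: smult_minus_left)
  also have "det (?c Y) = [:det Y:]" by simp
  finally show ?thesis
    by (cases "even n") auto
qed

lemma gen_eigenvalue_real:
  fixes a :: complex
  assumes X: "X \<in> carrier_mat n n" and Y: "Y \<in> carrier_mat n n"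
    and sX: "symmetric_mat X" and sY: "symmetric_mat Y" and pd: "pos_def_mat Y"
    and v: "v \<in> carrier_vec n" "v \<noteq> 0\<^sub>v n"
    and ev: "map_mat of_real X *\<^sub>v v = a \<cdot>\<^sub>v (map_mat of_real Y *\<^sub>v v)"
  shows "Im a = 0"
proof -
  define u where "u = map_vec Re v"
  define w where "w = map_vec Im v"
  have uw: "u \<in> carrier_vec n" "w \<in> carrier_vec n" using v by (auto simp: u_def w_def)
  have ip: "(map_mat complex_of_real M *\<^sub>v v) $ i = Complex ((M *\<^sub>v u) $ i) ((M *\<^sub>v w) $ i)"
    if "M \<in> carrier_mat n n" "i < n" for M i
    using that v by (auto simp: scalar_prod_def u_def w_def complex_eq_iff)
  have comp: "Complex ((X *\<^sub>v u) $ i) ((X *\<^sub>v w) $ i)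
     = a * Complex ((Y *\<^sub>v u) $ i) ((Y *\<^sub>v w) $ i)" if "i < n" for i
    using arg_cong[OF ev, of "\<lambda>z. z $ i"] ip[OF X that] ip[OF Y that] that Y by simp
  have Xu: "X *\<^sub>v u = Re a \<cdot>\<^sub>v (Y *\<^sub>v u) - Im a \<cdot>\<^sub>v (Y *\<^sub>v w)"
    by (rule eq_vecI) (use comp X Y uw in \<open>auto simp: complex_eq_iff simp del: index_mult_mat_vec\<close>)
  have Xw: "X *\<^sub>v w = Re a \<cdot>\<^sub>v (Y *\<^sub>v w) + Im a \<cdot>\<^sub>v (Y *\<^sub>v u)"
    by (rule eq_vecI) (use comp X Y uw in \<open>auto simp: complex_eq_iff simp del: index_mult_mat_vec\<close>)
  have swap: "u \<bullet> (M *\<^sub>v w) = w \<bullet> (M *\<^sub>v u)" if M: "M \<in> carrier_mat n n" "symmetric_mat M" for M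
  proof -
    have "u \<bullet> (M *\<^sub>v w) = (transpose_mat M *\<^sub>v u) \<bullet> w"
      using transpose_vec_mult_scalar[OF M(1) uw(2,1)] by simp
    then show ?thesis
      using M uw unfolding symmetric_mat_def by (metis comm_scalar_prod mult_mat_vec_carrier)
  qed
  have c: "Y *\<^sub>v u \<in> carrier_vec n" "Y *\<^sub>v w \<in> carrier_vec n" using Y uw by auto
  have "u \<bullet> (X *\<^sub>v w) = Re a * (u \<bullet> (Y *\<^sub>v w)) + Im a * (u \<bullet> (Y *\<^sub>v u))"
    unfolding Xw using c uw by (subst scalar_prod_add_distrib[of _ n]) auto
  moreover have "w \<bullet> (X *\<^sub>v u) = Re a * (w \<bullet> (Y *\<^sub>v u)) - Im a * (w \<bullet> (Y *\<^sub>v w))"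
    unfolding Xu using c uw by (subst scalar_prod_minus_distrib[of _ n]) auto
  ultimately have key: "Im a * (u \<bullet> (Y *\<^sub>v u) + w \<bullet> (Y *\<^sub>v w)) = 0"
    using swap[OF X sX] swap[OF Y sY] by (simp add: algebra_simps)
  have nn: "z \<bullet> (Y *\<^sub>v z) \<ge> 0 \<and> (z \<noteq> 0\<^sub>v n \<longrightarrow> z \<bullet> (Y *\<^sub>v z) > 0)" if "z \<in> carrier_vec n" for z
    using pd Y that unfolding pos_def_mat_def by (cases "z = 0\<^sub>v n") (auto simp: less_imp_le)
  have "u \<noteq> 0\<^sub>v n \<or> w \<noteq> 0\<^sub>v n"
  proof (rule ccontr)
    assume "\<not> ?thesis"
    then have *: "u = 0\<^sub>v n" "w = 0\<^sub>v n" by auto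
    have "v = 0\<^sub>v n"
    proof (rule eq_vecI)
      fix i assume "i < dim_vec (0\<^sub>v n :: complex vec)"
      then show "v $ i = 0\<^sub>v n $ i"
        using arg_cong[OF *(1), of "\<lambda>z. z $ i"] arg_cong[OF *(2), of "\<lambda>z. z $ i"] v
        by (auto simp: u_def w_def complex_eq_iff)
    qed (use v in auto)
    then show False using v by simp
  qed
  then have "u \<bullet> (Y *\<^sub>v u) + w \<bullet> (Y *\<^sub>v w) > 0"
    using nn[OF uw(1)] nn[OF uw(2)] by linarith
  then show ?thesis using key by simp
qed

lemma
  assumes X: "X \<in> carrier_mat n n" and Y: "Y \<in> carrier_mat n n"
    and sX: "symmetric_mat X" and sY: "symmetric_mat Y" and pd: "pos_def_mat Y"
  shows size_gen_eigenvalue_mset: "size (gen_eigenvalue_mset X Y) = n"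
    and set_gen_eigenvalue_mset: "set_mset (gen_eigenvalue_mset X Y) = gen_spectrum X Y"
proof -
  obtain Z where Z: "Z \<in> carrier_mat n n" "Z * Y = 1\<^sub>m n" "Y * Z = 1\<^sub>m n"
    using pos_def_mat_inverse[OF Y pd] .
  have ZX: "Z * X \<in> carrier_mat n n" using Z X by auto
  let ?f = "map_mat complex_of_real"
  have fZX: "?f (Z * X) \<in> carrier_mat n n" using ZX by auto
  obtain as where as: "char_poly (?f (Z * X)) = (\<Prod>a\<leftarrow>as. [:- a, 1:])" "length as = n"
    using char_poly_factorized[OF fZX] by auto
  have real: "complex_of_real (Re a) = a" if "a \<in> set as" for a
  proof -
    have "poly (char_poly (?f (Z * X))) a = 0"
      unfolding as(1) using that by (auto simp: poly_prod_list o_def prod_list_zero_iff)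
    then have "eigenvalue (?f (Z * X)) a" using eigenvalue_root_char_poly[OF fZX] by simp
    then obtain v where v: "v \<in> carrier_vec n" "v \<noteq> 0\<^sub>v n" "?f (Z * X) *\<^sub>v v = a \<cdot>\<^sub>v v"
      unfolding eigenvalue_def eigenvector_def using X Z by auto
    have "Y * (Z * X) = X" using X Y Z by (simp flip: assoc_mult_mat)
    then have "?f X = ?f Y * ?f (Z * X)"
      using of_real_hom.mat_hom_mult[OF Y ZX, where ?'a = complex] by simp
    then have "?f X *\<^sub>v v = ?f Y *\<^sub>v (a \<cdot>\<^sub>v v)"
      using assoc_mult_mat_vec[of "?f Y" n n "?f (Z * X)" n v] Y fZX v by auto
    also have "\<dots> = a \<cdot>\<^sub>v (?f Y *\<^sub>v v)"
      using Y v by (intro mult_mat_vec[of _ n n]) auto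
    finally have "Im a = 0" using gen_eigenvalue_real[OF X Y sX sY pd v(1,2)] by blast
    then show ?thesis by (simp add: complex_eq_iff)
  qed
  interpret m: map_poly_inj_comm_ring_hom "of_real :: real \<Rightarrow> complex" ..
  have "map_poly complex_of_real (char_poly (Z * X))
     = (\<Prod>a\<leftarrow>as. [:- complex_of_real (Re a), 1:])"
    unfolding of_real_hom.char_poly_hom[OF ZX, symmetric] as(1)
    by (intro arg_cong[of _ _ prod_list] map_cong) (auto simp: real)
  also have "\<dots> = map_poly complex_of_real (\<Prod>a\<leftarrow>as. [:- Re a, 1:])"
    by (simp add: m.hom_prod_list o_def hom_distribs)
  finally have cp: "char_poly (Z * X) = (\<Prod>a\<leftarrow>as. [:- Re a, 1:])" by simp
  have "det Y * det Z = 1" using det_mult[OF Y Z(1)] Z by simp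
  then have nz: "(- 1) ^ n * det Y \<noteq> 0" by auto
  note pp = pencil_poly_char_poly[OF X Y Z(1) Z(3)]
  have "gen_eigenvalue_mset X Y = proots (\<Prod>a\<leftarrow>as. [:- Re a, 1:])"
    unfolding gen_eigenvalue_mset_def pp using nz by (simp add: cp)
  also have "\<dots> = mset (map Re as)"
  proof (induction as)
    case (Cons a as)
    have "(\<Prod>a\<leftarrow>as. [:- Re a, 1:]) \<noteq> 0" by (auto simp: prod_list_zero_iff)
    then show ?case
      using Cons by (simp add: proots_mult del: mult_pCons_left)
  qed simp
  finally show "size (gen_eigenvalue_mset X Y) = n" using as(2) by simp
  have "pencil_poly X Y \<noteq> 0"
    unfolding pp cp using nz by (auto simp: prod_list_zero_iff)
  then show "set_mset (gen_eigenvalue_mset X Y) = gen_spectrum X Y"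
    unfolding gen_eigenvalue_mset_def gen_spectrum_def
    by (simp add: pencil_poly_poly[OF X Y])
qed

end

theory Submission
  imports Defs "Jordan_Normal_Form.Schur_Decomposition"
begin

text \<open>
  Everything follows from a comparison of quadratic forms. If \<open>B\<close> is symmetric, averaging the
  lumped terms over \<open>(j, k)\<close> and \<open>(k, j)\<close> turns \<open>v\<^sup>T P\<^sub>i v\<close> into a sum over all positions \<open>(j, k)\<close>
  whose summand is \<open>b\<^sub>j\<^sub>k v\<^sub>j v\<^sub>k\<close> inside the band \<open>\<bar>j - k\<bar> < i\<close> and
  \<open>\<bar>b\<^sub>j\<^sub>k\<bar> (v\<^sub>j\<^sup>2 + v\<^sub>k\<^sup>2) / 2\<close> outside (\<open>lumped_precond_quadratic_form\<close>). The second expression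
  dominates the first, so widening the band decreases the form term by term:
  \<open>v\<^sup>T B v \<le> v\<^sup>T P\<^sub>i\<^sub>+\<^sub>1 v \<le> v\<^sup>T P\<^sub>i v\<close>. In particular every \<open>P\<^sub>i\<close> is positive definite.

  If \<open>B v = l P\<^sub>i v\<close> with \<open>v \<noteq> 0\<close>, then \<open>l\<close> is the quotient of \<open>v\<^sup>T B v\<close> by \<open>v\<^sup>T P\<^sub>i v\<close>, whence
  \<open>0 < l \<le> 1\<close>. If \<open>B\<close> is nonnegative, lumping preserves row sums, so the all-ones vector is an
  eigenvector of the pencil for the eigenvalue \<open>1\<close>, which is then the largest one.

  The monotonicity of the \<open>k\<close>-th eigenvalue rests on a min-max argument: for positive definite \<open>X\<close>,
  the \<open>k\<close>-th eigenvalue of \<open>(X, Y)\<close> is at most that of \<open>(X, Y')\<close> if the form of \<open>Y\<close> dominates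
  that of \<open>Y'\<close> (\<open>gen_eigenvalue_antimono\<close>). Take bases that diagonalize the two pencils
  (\<open>simultaneous_diagonalization\<close>). The eigenvectors numbered \<open>k, \<dots>, n\<close> of \<open>(X, Y)\<close> and those
  numbered \<open>1, \<dots>, k\<close> of \<open>(X, Y')\<close> span spaces whose dimensions add up to \<open>n + 1\<close>; a nonzero
  vector in their intersection has Rayleigh quotients that separate the two eigenvalues.
  Simultaneous diagonalization results from applying the spectral theorem first to \<open>Y\<close>, in order
  to reduce it to the identity by a congruence, and then to the transformed \<open>X\<close>.
\<close>

section \<open>The spectral theorem for real symmetric matrices\<close>

lemma symmetric_mat_index:
  assumes "A \<in> carrier_mat n n" "symmetric_mat A" "i < n" "j < n"
  shows "A $$ (j, i) = A $$ (i, j)"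
  using assms by (metis carrier_matD index_transpose_mat(1) symmetric_mat_def)

lemma symmetric_mat_congruence:
  assumes A: "A \<in> carrier_mat n n" "symmetric_mat A" and W: "W \<in> carrier_mat n m"
  shows "symmetric_mat (transpose_mat W * A * W)"
proof -
  have "transpose_mat (transpose_mat W * A * W) = transpose_mat W * transpose_mat (transpose_mat W * A)"
    by (rule transpose_mult[of _ m n _ m]) (use A W in auto)
  also have "transpose_mat (transpose_mat W * A) = transpose_mat A * W"
    using transpose_mult[of "transpose_mat W" m n A n] A W by simp
  finally show ?thesis using A W by (simp add: symmetric_mat_def)
qed

lemma congruence_mult:
  assumes "A \<in> carrier_mat n n" "S \<in> carrier_mat n n" "T \<in> carrier_mat n n"
  shows "transpose_mat (S * T) * A * (S * T)
    = transpose_mat T * (transpose_mat S * A * S) * (T :: 'a :: comm_semiring_1 mat)"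
  using assms by (simp add: transpose_mult[of S n n T n] assoc_mult_mat[of _ n n _ n _ n]
      mult_carrier_mat[of _ n n _ n] del: assoc_mult_mat)

lemma orthogonal_mat_with_first_col:
  fixes v :: "real vec"
  assumes v: "v \<in> carrier_vec n" "v \<noteq> 0\<^sub>v n"
  obtains W c where "W \<in> carrier_mat n n" "transpose_mat W * W = 1\<^sub>m n" "col W 0 = c \<cdot>\<^sub>v v"
proof -
  interpret cof_vec_space n "TYPE(real)" .
  define b where "b = basis_completion v"
  define ws where "ws = gram_schmidt n b"
  from basis_completion[OF v, folded b_def]
  have b: "distinct b" "\<not> lin_dep (set b)" "set b \<subseteq> carrier_vec n" "hd b = v" "length b = n"
    by auto
  have n: "n \<noteq> 0" using v by auto
  then obtain vs where bv: "b = v # vs" using b by (cases b) auto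
  from gram_schmidt_result[OF b(3,1,2) refl, folded ws_def]
  have ws: "set ws \<subseteq> carrier_vec n" "corthogonal ws" "length ws = n" by (auto simp: b)
  have hd: "ws ! 0 = v"
    using gram_schmidt_hd[OF v(1), of vs, folded bv] ws(3) n
    unfolding ws_def by (metis hd_conv_nth list.size(3))
  have wsc: "ws ! i \<in> carrier_vec n" if "i < n" for i using ws that by auto
  define c where "c i = 1 / sqrt (ws ! i \<bullet> ws ! i)" for i
  have pos: "ws ! i \<bullet> ws ! i > 0" if "i < n" for i
  proof -
    have "ws ! i \<bullet> ws ! i \<noteq> 0" using corthogonalD[OF ws(2), of i i] that ws(3) by simp
    moreover have "ws ! i \<bullet> ws ! i \<ge> 0" by (simp add: scalar_prod_def sum_nonneg)
    ultimately show ?thesis by simp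
  qed
  define W where "W = mat_of_cols n (map (\<lambda>i. c i \<cdot>\<^sub>v ws ! i) [0..<n])"
  have W: "W \<in> carrier_mat n n"
    unfolding W_def using mat_of_cols_carrier(1)[of n "map (\<lambda>i. c i \<cdot>\<^sub>v ws ! i) [0..<n]"] by simp
  have colW: "col W i = c i \<cdot>\<^sub>v ws ! i" if "i < n" for i
    unfolding W_def using that wsc[OF that] by (subst col_mat_of_cols) auto
  have "transpose_mat W * W = 1\<^sub>m n"
  proof (rule eq_matI)
    fix i j assume "i < dim_row (1\<^sub>m n :: real mat)" "j < dim_col (1\<^sub>m n :: real mat)"
    then have ij: "i < n" "j < n" by auto
    have "(transpose_mat W * W) $$ (i, j) = col W i \<bullet> col W j" using W ij by simp
    also have "\<dots> = c i * c j * (ws ! i \<bullet> ws ! j)"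
      using wsc[OF ij(1)] wsc[OF ij(2)] ij by (simp add: colW)
    also have "\<dots> = 1\<^sub>m n $$ (i, j)"
    proof (cases "i = j")
      case True
      then show ?thesis using pos[OF ij(1)] ij by (simp add: c_def)
    next
      case False
      then have "ws ! i \<bullet> ws ! j = 0" using corthogonalD[OF ws(2), of i j] ij ws(3) by simp
      then show ?thesis using False ij by simp
    qed
    finally show "(transpose_mat W * W) $$ (i, j) = 1\<^sub>m n $$ (i, j)" .
  qed (use W in auto)
  then show thesis using that[OF W, of "c 0"] colW[of 0] hd n by simp
qed

text \<open>
  The eigenvalues appear in the order of the given factorization of the characteristic polynomial,
  so that they can later be taken in ascending order. The induction splits off the first one:
  in an orthonormal basis starting with an eigenvector, the symmetric matrix is block diagonal.
\<close>

lemma spectral_theorem_factorized: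
  fixes A :: "real mat"
  assumes "A \<in> carrier_mat n n" "symmetric_mat A" "char_poly A = (\<Prod>e\<leftarrow>es. [:- e, 1:])"
  obtains W where "W \<in> carrier_mat n n" "transpose_mat W * W = 1\<^sub>m n"
    "transpose_mat W * A * W = mat_diag n (\<lambda>i. es ! i)"
  using assms
proof (induction es arbitrary: n A thesis)
  case Nil
  then have "n = 0" using degree_monic_char_poly[of A n] by simp
  then show ?case using Nil.prems(2) by (intro Nil.prems(1)[of "1\<^sub>m 0"])
    (auto simp: mat_diag_def intro!: eq_matI)
next
  case (Cons e es)
  note A = Cons.prems(2,3)
  have "poly (char_poly A) e = 0" by (simp add: Cons.prems(4))
  then obtain v where v: "v \<in> carrier_vec n" "v \<noteq> 0\<^sub>v n" and ev: "A *\<^sub>v v = e \<cdot>\<^sub>v v"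
    using eigenvalue_root_char_poly[OF A(1)] A(1) unfolding eigenvalue_def eigenvector_def by auto
  then obtain m where n: "n = Suc m" by (cases n) auto
  obtain W c where W: "W \<in> carrier_mat n n" "transpose_mat W * W = 1\<^sub>m n" "col W 0 = c \<cdot>\<^sub>v v"
    using orthogonal_mat_with_first_col[OF v] .
  have W': "W * transpose_mat W = 1\<^sub>m n"
    by (rule mat_mult_left_right_inverse) (use W in auto)
  define A1 where "A1 = transpose_mat W * A * W"
  have A1: "A1 \<in> carrier_mat n n" "symmetric_mat A1"
    using A W symmetric_mat_congruence[OF A W(1)] by (auto simp: A1_def)
  have "col (A * W) 0 = A *\<^sub>v (c \<cdot>\<^sub>v v)"
    using col_mult2[OF A(1) W(1), of 0] n W(3) by simp
  also have "\<dots> = e \<cdot>\<^sub>v col W 0"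
    unfolding mult_mat_vec[OF A(1) v(1)] ev W(3) by (simp only: smult_smult_assoc mult.commute)
  finally have AW: "col (A * W) 0 = e \<cdot>\<^sub>v col W 0" .
  have col0: "A1 $$ (i, 0) = (if i = 0 then e else 0)" if i: "i < n" for i
  proof -
    have "A1 = transpose_mat W * (A * W)" using A W by (simp add: A1_def)
    then have "A1 $$ (i, 0) = col W i \<bullet> col (A * W) 0" using A W i n by simp
    also have "\<dots> = e * (transpose_mat W * W) $$ (i, 0)"
      unfolding AW using W(1) i n by simp
    finally show ?thesis using W(2) i n by simp
  qed
  have row0: "A1 $$ (0, i) = (if i = 0 then e else 0)" if "i < n" for i
    using col0[OF that] symmetric_mat_index[OF A1 that, of 0] n by simp
  define A3 where "A3 = mat m m (\<lambda>(i, j). A1 $$ (Suc i, Suc j))"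
  let ?e = "mat 1 1 (\<lambda>_. e)"
  have A3: "A3 \<in> carrier_mat m m" "symmetric_mat A3"
    using symmetric_mat_index[OF A1] n by (auto simp: A3_def symmetric_mat_def intro!: eq_matI)
  have block: "A1 = four_block_mat ?e (0\<^sub>m 1 m) (0\<^sub>m m 1) A3"
  proof (rule eq_matI)
    fix i j assume "i < dim_row (four_block_mat ?e (0\<^sub>m 1 m) (0\<^sub>m m 1) A3)"
      "j < dim_col (four_block_mat ?e (0\<^sub>m 1 m) (0\<^sub>m m 1) A3)"
    then show "A1 $$ (i, j) = four_block_mat ?e (0\<^sub>m 1 m) (0\<^sub>m m 1) A3 $$ (i, j)"
      using n A3(1) col0 row0 by (cases i; cases j) (auto simp: A3_def)
  qed (use A1 A3 n in auto)
  have "similar_mat_wit A1 A (transpose_mat W) W"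
    by (rule similar_mat_witI[of _ _ n]) (use W W' A A1 in \<open>auto simp: A1_def\<close>)
  then have "char_poly A1 = [:- e, 1:] * (\<Prod>e\<leftarrow>es. [:- e, 1:])"
    using char_poly_similar Cons.prems(4) unfolding similar_mat_def by force
  moreover have "char_poly A1 = char_poly ?e * char_poly A3"
    unfolding block by (rule char_poly_four_block_zeros_col) (use A3 in auto)
  moreover have "char_poly ?e = [:- e, 1:]"
    by (simp add: char_poly_defs det_def sign_def)
  ultimately have "char_poly A3 = (\<Prod>e\<leftarrow>es. [:- e, 1:])"
    by (metis mult_cancel_left pCons_eq_0_iff zero_neq_one)
  then obtain V where V: "V \<in> carrier_mat m m" "transpose_mat V * V = 1\<^sub>m m"
      "transpose_mat V * A3 * V = mat_diag m (\<lambda>i. es ! i)"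
    using Cons.IH[OF _ A3] by blast
  define F where "F = four_block_mat (1\<^sub>m 1) (0\<^sub>m 1 m) (0\<^sub>m m 1) V"
  have F: "F \<in> carrier_mat n n" using V n by (auto simp: F_def)
  have FT: "transpose_mat F = four_block_mat (1\<^sub>m 1) (0\<^sub>m 1 m) (0\<^sub>m m 1) (transpose_mat V)"
    unfolding F_def using V by (subst transpose_four_block_mat[of _ 1 1 _ m _ m]) auto
  have FF: "transpose_mat F * F = 1\<^sub>m n"
    unfolding FT unfolding F_def using V n
    by (subst mult_four_block_mat[of _ 1 1 _ m _ m _ _ 1 _ m]) auto
  have "transpose_mat F * A1 = four_block_mat ?e (0\<^sub>m 1 m) (0\<^sub>m m 1) (transpose_mat V * A3)"
    unfolding FT block using V A3
    by (subst mult_four_block_mat[of _ 1 1 _ m _ m _ _ 1 _ m]) auto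
  then have "transpose_mat F * A1 * F
      = four_block_mat ?e (0\<^sub>m 1 m) (0\<^sub>m m 1) (transpose_mat V * A3 * V)"
    unfolding F_def using V(1) A3
    by (simp, subst mult_four_block_mat[of _ 1 1 _ m _ m _ _ 1 _ m]) auto
  also have "\<dots> = mat_diag n (\<lambda>i. (e # es) ! i)"
    unfolding V(3) by (rule eq_matI) (auto simp: n mat_diag_def nth_Cons')
  finally have D: "transpose_mat (W * F) * A * (W * F) = mat_diag n (\<lambda>i. (e # es) ! i)"
    using congruence_mult[OF A(1) W(1) F] by (simp add: A1_def)
  have "transpose_mat (W * F) * (W * F) = 1\<^sub>m n"
    using congruence_mult[of "1\<^sub>m n" n W F] W F FF by simp
  then show ?case using D W F by (intro Cons.prems(1)[of "W * F"]) auto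
qed

lemma symmetric_char_poly_splits:
  assumes A: "A \<in> carrier_mat n n" "symmetric_mat A"
  obtains es where "char_poly A = (\<Prod>e\<leftarrow>es. [:- e, 1:])" "sorted es" "length es = n"
proof -
  let ?f = "map_mat complex_of_real"
  have fA: "?f A \<in> carrier_mat n n" using A by simp
  obtain as where as: "char_poly (?f A) = (\<Prod>a\<leftarrow>as. [:- a, 1:])" "length as = n"
    using char_poly_factorized[OF fA] by auto
  have pd1: "pos_def_mat (1\<^sub>m n)"
    by (auto simp: pos_def_mat_def order.strict_iff_order
        scalar_prod_def sum_nonneg sum_nonneg_eq_0_iff intro!: eq_vecI)
  have real: "complex_of_real (Re a) = a" if "a \<in> set as" for a
  proof -
    have "poly (char_poly (?f A)) a = 0"
      unfolding as(1) using that by (auto simp: poly_prod_list o_def prod_list_zero_iff)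
    then obtain v where v: "v \<in> carrier_vec n" "v \<noteq> 0\<^sub>v n" "?f A *\<^sub>v v = a \<cdot>\<^sub>v v"
      using eigenvalue_root_char_poly[OF fA] A unfolding eigenvalue_def eigenvector_def by auto
    have "?f (1\<^sub>m n) = 1\<^sub>m n" by (rule eq_matI) auto
    then have "?f A *\<^sub>v v = a \<cdot>\<^sub>v (?f (1\<^sub>m n) *\<^sub>v v)" using v by simp
    then have "Im a = 0"
      using gen_eigenvalue_real[OF A(1) _ A(2) _ pd1 v(1,2)] by (simp add: symmetric_mat_def)
    then show ?thesis by (simp add: complex_eq_iff)
  qed
  interpret m: map_poly_inj_comm_ring_hom "of_real :: real \<Rightarrow> complex" ..
  have "map_poly complex_of_real (char_poly A) = (\<Prod>a\<leftarrow>as. [:- complex_of_real (Re a), 1:])"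
    unfolding of_real_hom.char_poly_hom[OF A(1), symmetric] as(1)
    by (intro arg_cong[of _ _ prod_list] map_cong) (auto simp: real)
  also have "\<dots> = map_poly complex_of_real (\<Prod>a\<leftarrow>as. [:- Re a, 1:])"
    by (simp add: m.hom_prod_list o_def hom_distribs)
  finally have cp: "char_poly A = (\<Prod>e\<leftarrow>map Re as. [:- e, 1:])" by (simp add: o_def)
  also have "\<dots> = (\<Prod>e\<leftarrow>sort (map Re as). [:- e, 1:])"
    by (simp only: prod_mset_prod_list[symmetric] mset_map mset_sort)
  finally show thesis using as(2) by (intro that) auto
qed

section \<open>Simultaneous diagonalization of a definite pencil\<close>

lemma quadratic_form_congruence:
  fixes X :: "'a :: comm_semiring_1 mat"
  assumes "X \<in> carrier_mat n n" "Q \<in> carrier_mat n n" "a \<in> carrier_vec n"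
  shows "(Q *\<^sub>v a) \<bullet> (X *\<^sub>v (Q *\<^sub>v a)) = a \<bullet> (transpose_mat Q * X * Q *\<^sub>v a)"
proof -
  have "transpose_mat Q * X \<in> carrier_mat n n" using assms by auto
  then have "transpose_mat Q * X * Q *\<^sub>v a = transpose_mat Q *\<^sub>v (X *\<^sub>v (Q *\<^sub>v a))"
    using assms by (simp add: assoc_mult_mat_vec[of _ n n _ n] del: assoc_mult_mat assoc_mult_mat_vec)
  then show ?thesis
    using transpose_vec_mult_scalar[of "transpose_mat Q" n n "X *\<^sub>v (Q *\<^sub>v a)" a] assms by simp
qed

lemma quadratic_form_mat_diag:
  fixes d :: "nat \<Rightarrow> 'a :: comm_semiring_1"
  assumes "a \<in> carrier_vec n"
  shows "a \<bullet> (mat_diag n d *\<^sub>v a) = (\<Sum>i<n. d i * (a $ i)\<^sup>2)"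
proof -
  have "(mat_diag n d *\<^sub>v a) $ i = d i * a $ i" if "i < n" for i
  proof -
    have "(mat_diag n d *\<^sub>v a) $ i = (\<Sum>j<n. (if i = j then d j else 0) * a $ j)"
      using assms that by (simp add: mat_diag_def scalar_prod_def atLeast0LessThan)
    also have "\<dots> = (\<Sum>j<n. if j = i then d i * a $ i else 0)"
      by (intro sum.cong) auto
    finally show ?thesis using that by simp
  qed
  then show ?thesis
    using assms by (simp add: scalar_prod_def mat_diag_def atLeast0LessThan power2_eq_square algebra_simps)
qed

lemma pos_def_matD:
  assumes "pos_def_mat Y" "Y \<in> carrier_mat n n" "v \<in> carrier_vec n" "v \<noteq> 0\<^sub>v n"
  shows "v \<bullet> (Y *\<^sub>v v) > 0"
  using assms by (auto simp: pos_def_mat_def)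

lemma pos_def_mat_congruent_one:
  assumes Y: "Y \<in> carrier_mat n n" "symmetric_mat Y" "pos_def_mat Y"
  obtains S where "S \<in> carrier_mat n n" "transpose_mat S * Y * S = 1\<^sub>m n"
proof -
  obtain es where "char_poly Y = (\<Prod>e\<leftarrow>es. [:- e, 1:])"
    using symmetric_char_poly_splits[OF Y(1,2)] by blast
  then obtain U where U: "U \<in> carrier_mat n n" "transpose_mat U * U = 1\<^sub>m n"
      "transpose_mat U * Y * U = mat_diag n (\<lambda>i. es ! i)"
    using spectral_theorem_factorized[OF Y(1,2)] by blast
  have pos: "es ! i > 0" if i: "i < n" for i
  proof -
    let ?u = "unit_vec n i :: real vec"
    have "U *\<^sub>v ?u \<noteq> 0\<^sub>v n"
    proof
      assume "U *\<^sub>v ?u = 0\<^sub>v n"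
      then have "transpose_mat U * U *\<^sub>v ?u = transpose_mat U *\<^sub>v 0\<^sub>v n" using U(1) by simp
      also have "\<dots> = 0\<^sub>v n" using U(1) by (intro eq_vecI) auto
      finally have "transpose_mat U * U *\<^sub>v ?u = 0\<^sub>v n" .
      then have "?u = 0\<^sub>v n" using U(2) by simp
      then show False using i by (metis index_unit_vec(1) index_zero_vec(1) zero_neq_one)
    qed
    then have "0 < (U *\<^sub>v ?u) \<bullet> (Y *\<^sub>v (U *\<^sub>v ?u))"
      using U by (intro pos_def_matD[OF Y(3,1)]) auto
    also have "\<dots> = (\<Sum>j<n. es ! j * (?u $ j)\<^sup>2)"
      using quadratic_form_congruence[OF Y(1) U(1), of ?u] quadratic_form_mat_diag[of ?u n]
      by (simp add: U(3))
    also have "\<dots> = (\<Sum>j<n. if j = i then es ! i else 0)"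
      using i by (intro sum.cong) auto
    also have "\<dots> = es ! i" using i by simp
    finally show ?thesis .
  qed
  let ?T = "mat_diag n (\<lambda>i. 1 / sqrt (es ! i))"
  have "transpose_mat ?T = ?T" by (rule eq_matI) (auto simp: mat_diag_def)
  then have "transpose_mat (U * ?T) * Y * (U * ?T)
      = mat_diag n (\<lambda>i. 1 / sqrt (es ! i) * (es ! i) * (1 / sqrt (es ! i)))"
    using congruence_mult[OF Y(1) U(1) mat_diag_dim] U(3) by simp
  also have "\<dots> = 1\<^sub>m n"
  proof (rule eq_matI)
    fix i j assume "i < dim_row (1\<^sub>m n :: real mat)" "j < dim_col (1\<^sub>m n :: real mat)"
    then show "mat_diag n (\<lambda>i. 1 / sqrt (es ! i) * (es ! i) * (1 / sqrt (es ! i))) $$ (i, j)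
        = 1\<^sub>m n $$ (i, j)"
      using pos[of i] by (cases "i = j") (auto simp: mat_diag_def)
  qed (auto simp: mat_diag_def)
  finally show thesis using U by (intro that[of "U * ?T"]) auto
qed

lemma proots_linear_factors:
  "proots (\<Prod>e\<leftarrow>es. [:- e, 1:]) = mset (es :: 'a :: idom list)"
proof (induction es)
  case (Cons e es)
  have "(\<Prod>e\<leftarrow>es. [:- e, 1:]) \<noteq> 0" by (auto simp: prod_list_zero_iff)
  then show ?case using Cons by (simp add: proots_mult del: mult_pCons_left)
qed simp

text \<open>
  If \<open>S\<^sup>T Y S = 1\<close>, then \<open>Y\<inverse> X\<close> is similar to \<open>S\<^sup>T X S\<close>; this identifies the diagonal entries with
  the roots of the pencil polynomial, including their multiplicities.
\<close>

theorem simultaneous_diagonalization: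
  assumes X: "X \<in> carrier_mat n n" "symmetric_mat X"
    and Y: "Y \<in> carrier_mat n n" "symmetric_mat Y" "pos_def_mat Y"
  obtains Q es where "Q \<in> carrier_mat n n" "transpose_mat Q * Y * Q = 1\<^sub>m n"
    "transpose_mat Q * X * Q = mat_diag n (\<lambda>i. es ! i)"
    "sorted es" "length es = n" "gen_eigenvalue_mset X Y = mset es"
proof -
  obtain S where S: "S \<in> carrier_mat n n" "transpose_mat S * Y * S = 1\<^sub>m n"
    using pos_def_mat_congruent_one[OF Y] .
  define X1 where "X1 = transpose_mat S * X * S"
  have X1: "X1 \<in> carrier_mat n n" "symmetric_mat X1"
    using symmetric_mat_congruence[OF X S(1)] X S by (auto simp: X1_def)
  obtain es where es: "char_poly X1 = (\<Prod>e\<leftarrow>es. [:- e, 1:])" "sorted es" "length es = n"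
    using symmetric_char_poly_splits[OF X1] .
  obtain V where V: "V \<in> carrier_mat n n" "transpose_mat V * V = 1\<^sub>m n"
      "transpose_mat V * X1 * V = mat_diag n (\<lambda>i. es ! i)"
    using spectral_theorem_factorized[OF X1 es(1)] .
  have QY: "transpose_mat (S * V) * Y * (S * V) = 1\<^sub>m n"
    using congruence_mult[OF Y(1) S(1) V(1)] S V by simp
  have QX: "transpose_mat (S * V) * X * (S * V) = mat_diag n (\<lambda>i. es ! i)"
    using congruence_mult[OF X(1) S(1) V(1)] V by (simp add: X1_def)
  \<comment> \<open>\<open>Z\<close> is the inverse of \<open>Y\<close>.\<close>
  define Z where "Z = S * transpose_mat S"
  have Z: "Z \<in> carrier_mat n n" using S by (auto simp: Z_def)
  have SYS: "S * (transpose_mat S * Y) = 1\<^sub>m n"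
    by (rule mat_mult_left_right_inverse) (use S Y in auto)
  then have ZY: "Z * Y = 1\<^sub>m n" using S Y by (simp add: Z_def)
  then have YZ: "Y * Z = 1\<^sub>m n" using mat_mult_left_right_inverse[OF Z Y(1)] by simp
  have "Z * X = S * X1 * (transpose_mat S * Y)"
  proof -
    have "S * X1 * (transpose_mat S * Y) = Z * X * (S * (transpose_mat S * Y))"
      using S X Y by (simp add: X1_def Z_def assoc_mult_mat[of _ n n _ n _ n]
          mult_carrier_mat[of _ n n _ n] del: assoc_mult_mat)
    then show ?thesis using SYS X Z by simp
  qed
  then have "similar_mat_wit (Z * X) X1 S (transpose_mat S * Y)"
    by (intro similar_mat_witI[of _ _ n]) (use S SYS X X1 Y Z in auto)
  then have cp: "char_poly (Z * X) = (\<Prod>e\<leftarrow>es. [:- e, 1:])"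
    using char_poly_similar es(1) unfolding similar_mat_def by metis
  have "det Y * det Z = 1" using det_mult[OF Y(1) Z] YZ by simp
  then have "(- 1) ^ n * det Y \<noteq> 0" by auto
  then have "gen_eigenvalue_mset X Y = mset es"
    unfolding gen_eigenvalue_mset_def pencil_poly_char_poly[OF X(1) Y(1) Z YZ] cp
    by (simp add: proots_linear_factors)
  then show thesis using that[OF _ QY QX es(2,3)] S V by auto
qed

lemma gen_eigenvalue_nth:
  assumes "gen_eigenvalue_mset X Y = mset es" "sorted es"
  shows "gen_eigenvalue (Suc k) X Y = es ! k"
  using assms by (simp add: gen_eigenvalue_def sorted_sort_id)

section \<open>Monotonicity of the generalized eigenvalues\<close>

text \<open>
  Applied to a change of basis matrix \<open>R\<close>, this yields a nonzero vector in the intersection of the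
  span of the basis vectors from index \<open>k\<close> on with the span of the other basis up to index \<open>k\<close>.
\<close>

lemma exists_vec_in_intersection:
  fixes R :: "'a :: field mat"
  assumes R: "R \<in> carrier_mat n n" and k: "k < n"
  obtains a where "a \<in> carrier_vec n" "a \<noteq> 0\<^sub>v n" "\<And>i. i < k \<Longrightarrow> a $ i = 0"
    "\<And>i. k < i \<Longrightarrow> i < n \<Longrightarrow> (R *\<^sub>v a) $ i = 0"
proof -
  \<comment> \<open>The conditions are only \<open>n - 1\<close> linear equations; row \<open>k\<close> of the square system is zero.\<close>
  define M where "M = mat n n (\<lambda>(i, j). if i < k then (if j = i then 1 else 0)
    else if i = k then 0 else R $$ (i, j))"
  have M: "M \<in> carrier_mat n n" by (simp add: M_def)
  have "transpose_mat M *\<^sub>v unit_vec n k = 0\<^sub>v n"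
    using k by (intro eq_vecI) (auto simp: M_def scalar_prod_right_unit)
  moreover have "unit_vec n k \<noteq> (0\<^sub>v n :: 'a vec)"
    using k by (metis index_unit_vec(1) index_zero_vec(1) zero_neq_one)
  ultimately have "det (transpose_mat M) = 0"
    using det_0_iff_vec_prod_zero_field[of "transpose_mat M" n] M unit_vec_carrier[of n k]
    unfolding transpose_carrier_mat by blast
  then have "det M = 0" using det_transpose[OF M] by simp
  then obtain a where a: "a \<in> carrier_vec n" "a \<noteq> 0\<^sub>v n" "M *\<^sub>v a = 0\<^sub>v n"
    using det_0_iff_vec_prod_zero_field[OF M] by blast
  have Ma: "(\<Sum>j<n. M $$ (i, j) * a $ j) = 0" if "i < n" for i
    using arg_cong[OF a(3), of "\<lambda>v. v $ i"] that a(1) M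
    by (simp add: scalar_prod_def atLeast0LessThan)
  show thesis
  proof (rule that[OF a(1,2)])
    fix i assume i: "i < k"
    then have "(\<Sum>j<n. M $$ (i, j) * a $ j) = (\<Sum>j<n. if j = i then a $ j else 0)"
      using k by (intro sum.cong) (auto simp: M_def)
    then show "a $ i = 0" using Ma[of i] i k by simp
  next
    fix i assume i: "k < i" "i < n"
    then have "(R *\<^sub>v a) $ i = (\<Sum>j<n. M $$ (i, j) * a $ j)"
      using a R by (simp add: scalar_prod_def atLeast0LessThan M_def)
    then show "(R *\<^sub>v a) $ i = 0" using Ma i by simp
  qed
qed

text \<open>
  Positivity of \<open>X\<close> makes the eigenvalues of \<open>(X, Y')\<close> positive, so that enlarging
  \<open>v\<^sup>T Y' v\<close> to \<open>v\<^sup>T Y v\<close> preserves the upper estimate of \<open>v\<^sup>T X v\<close>.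
\<close>

theorem gen_eigenvalue_antimono:
  assumes X: "X \<in> carrier_mat n n" "symmetric_mat X" "pos_def_mat X"
    and Y: "Y \<in> carrier_mat n n" "symmetric_mat Y" "pos_def_mat Y"
    and Y': "Y' \<in> carrier_mat n n" "symmetric_mat Y'" "pos_def_mat Y'"
    and le: "\<And>v. v \<in> carrier_vec n \<Longrightarrow> v \<bullet> (Y' *\<^sub>v v) \<le> v \<bullet> (Y *\<^sub>v v)"
    and k: "k \<in> {1..n}"
  shows "gen_eigenvalue k X Y \<le> gen_eigenvalue k X Y'"
proof -
  obtain Q es where Q: "Q \<in> carrier_mat n n" "transpose_mat Q * Y * Q = 1\<^sub>m n"
    "transpose_mat Q * X * Q = mat_diag n (\<lambda>i. es ! i)"
    and es: "sorted es" "length es = n" "gen_eigenvalue_mset X Y = mset es"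
    using simultaneous_diagonalization[OF X(1,2) Y] .
  obtain Q' es' where Q': "Q' \<in> carrier_mat n n" "transpose_mat Q' * Y' * Q' = 1\<^sub>m n"
    "transpose_mat Q' * X * Q' = mat_diag n (\<lambda>i. es' ! i)"
    and es': "sorted es'" "length es' = n" "gen_eigenvalue_mset X Y' = mset es'"
    using simultaneous_diagonalization[OF X(1,2) Y'] .
  obtain m where km: "k = Suc m" and m: "m < n" using k by (cases k) auto
  have inv: "Q' * (transpose_mat Q' * Y') = 1\<^sub>m n"
    by (rule mat_mult_left_right_inverse) (use Q' Y' in auto)
  \<comment> \<open>Since \<open>transpose_mat Q' * Y'\<close> is the inverse of \<open>Q'\<close>, \<open>R\<close> converts coordinates with respect to
    \<open>Q\<close> into coordinates with respect to \<open>Q'\<close>.\<close>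
  define R where "R = transpose_mat Q' * Y' * Q"
  have R: "R \<in> carrier_mat n n" using Q Q' Y' by (simp add: R_def)
  obtain a where a: "a \<in> carrier_vec n" "a \<noteq> 0\<^sub>v n" "\<And>i. i < m \<Longrightarrow> a $ i = 0"
      "\<And>i. m < i \<Longrightarrow> i < n \<Longrightarrow> (R *\<^sub>v a) $ i = 0"
    using exists_vec_in_intersection[OF R m] by blast
  define b where "b = R *\<^sub>v a"
  have b: "b \<in> carrier_vec n" using R a by (simp add: b_def)
  define v where "v = Q *\<^sub>v a"
  have v: "v \<in> carrier_vec n" using Q a by (simp add: v_def)
  have vb: "v = Q' *\<^sub>v b"
  proof -
    have "Q' *\<^sub>v b = Q' * (transpose_mat Q' * Y') *\<^sub>v v"
      using Q(1) Q'(1) Y'(1) a(1)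
      by (simp add: b_def R_def v_def assoc_mult_mat_vec[of _ n n _ n] mult_carrier_mat[of _ n n _ n]
          mult_mat_vec_carrier[of _ n n] del: assoc_mult_mat assoc_mult_mat_vec)
    then show ?thesis using inv v by simp
  qed
  have one: "c \<bullet> (1\<^sub>m n *\<^sub>v c) = (\<Sum>i<n. (c $ i)\<^sup>2)" if "c \<in> carrier_vec n" for c :: "real vec"
    using that by (simp add: scalar_prod_def atLeast0LessThan power2_eq_square)
  have Xa: "v \<bullet> (X *\<^sub>v v) = (\<Sum>i<n. es ! i * (a $ i)\<^sup>2)"
    using quadratic_form_congruence[OF X(1) Q(1) a(1)] quadratic_form_mat_diag[OF a(1)]
    by (simp add: Q(3) v_def)
  have Xb: "v \<bullet> (X *\<^sub>v v) = (\<Sum>i<n. es' ! i * (b $ i)\<^sup>2)"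
    using quadratic_form_congruence[OF X(1) Q'(1) b(1)] quadratic_form_mat_diag[OF b(1)]
    by (simp add: Q'(3) vb)
  have Ya: "v \<bullet> (Y *\<^sub>v v) = (\<Sum>i<n. (a $ i)\<^sup>2)"
    using quadratic_form_congruence[OF Y(1) Q(1) a(1)] one[OF a(1)] by (simp add: Q(2) v_def)
  have Yb: "v \<bullet> (Y' *\<^sub>v v) = (\<Sum>i<n. (b $ i)\<^sup>2)"
    using quadratic_form_congruence[OF Y'(1) Q'(1) b(1)] one[OF b(1)] by (simp add: Q'(2) vb)
  have v0: "v \<noteq> 0\<^sub>v n"
  proof
    assume "v = 0\<^sub>v n"
    then have "(\<Sum>i<n. (a $ i)\<^sup>2) = 0" using Ya Y by simp
    then have "a = 0\<^sub>v n" using a(1) by (intro eq_vecI) (auto simp: sum_nonneg_eq_0_iff)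
    then show False using a(2) by simp
  qed
  have "es ! m * (v \<bullet> (Y *\<^sub>v v)) \<le> v \<bullet> (X *\<^sub>v v)"
    unfolding Xa Ya sum_distrib_left
  proof (rule sum_mono)
    fix i assume "i \<in> {..<n}"
    then show "es ! m * (a $ i)\<^sup>2 \<le> es ! i * (a $ i)\<^sup>2"
      using a(3)[of i] sorted_nth_mono[OF es(1), of m i] es(2)
      by (cases "i < m") (auto intro!: mult_right_mono)
  qed
  also have up: "v \<bullet> (X *\<^sub>v v) \<le> es' ! m * (v \<bullet> (Y' *\<^sub>v v))"
    unfolding Xb Yb sum_distrib_left
  proof (rule sum_mono)
    fix i assume "i \<in> {..<n}"
    then show "es' ! i * (b $ i)\<^sup>2 \<le> es' ! m * (b $ i)\<^sup>2"
      using a(4)[of i] sorted_nth_mono[OF es'(1), of i m] es'(2) m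
      by (cases "m < i") (auto intro!: mult_right_mono simp: b_def simp del: index_mult_mat_vec)
  qed
  also have "\<dots> \<le> es' ! m * (v \<bullet> (Y *\<^sub>v v))"
  proof (rule mult_left_mono[OF le[OF v]])
    have "0 < es' ! m * (v \<bullet> (Y' *\<^sub>v v))" using pos_def_matD[OF X(3,1) v v0] up by linarith
    then show "0 \<le> es' ! m" using pos_def_matD[OF Y'(3,1) v v0] by (simp add: zero_less_mult_iff)
  qed
  finally have "es ! m \<le> es' ! m" using pos_def_matD[OF Y(3,1) v v0] by simp
  then show ?thesis using gen_eigenvalue_nth[OF es(3,1)] gen_eigenvalue_nth[OF es'(3,1)] km by simp
qed

section \<open>The lumped preconditioners\<close>

lemma lumped_precond_carrier: "B \<in> carrier_mat n n \<Longrightarrow> lumped_precond i B \<in> carrier_mat n n"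
  by (auto simp: lumped_precond_def band_part_def lumping_def)

lemma lumped_precond_index:
  assumes "B \<in> carrier_mat n n" "j < n" "k < n"
  shows "lumped_precond i B $$ (j, k) = (if \<bar>int j - int k\<bar> < int i then B $$ (j, k) else 0)
    + (if j = k then (\<Sum>l<n. if \<bar>int j - int l\<bar> < int i then 0 else \<bar>B $$ (j, l)\<bar>) else 0)"
  using assms by (auto simp: lumped_precond_def band_part_def lumping_def mat_diag_def intro!: sum.cong)

lemma symmetric_lumped_precond:
  assumes "B \<in> carrier_mat n n" "symmetric_mat B"
  shows "symmetric_mat (lumped_precond i B)"
  unfolding symmetric_mat_def
  using assms lumped_precond_carrier[OF assms(1), of i] symmetric_mat_index[OF assms]
  by (intro eq_matI) (auto simp: lumped_precond_index abs_minus_commute)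

lemma quadratic_form_sum:
  fixes A :: "'a :: comm_semiring_0 mat"
  assumes "A \<in> carrier_mat n n" "v \<in> carrier_vec n"
  shows "v \<bullet> (A *\<^sub>v v) = (\<Sum>j<n. \<Sum>k<n. A $$ (j, k) * (v $ j * v $ k))"
  using assms by (simp add: scalar_prod_def atLeast0LessThan sum_distrib_left mult_ac)

lemma lumped_precond_quadratic_form:
  assumes B: "B \<in> carrier_mat n n" "symmetric_mat B" and v: "v \<in> carrier_vec n"
  shows "v \<bullet> (lumped_precond i B *\<^sub>v v) = (\<Sum>j<n. \<Sum>k<n.
    if \<bar>int j - int k\<bar> < int i then B $$ (j, k) * (v $ j * v $ k)
    else \<bar>B $$ (j, k)\<bar> * (((v $ j)\<^sup>2 + (v $ k)\<^sup>2) / 2))"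
proof -
  let ?in = "\<lambda>j k. \<bar>int j - int k\<bar> < int i"
  let ?D = "\<lambda>j k. if ?in j k then B $$ (j, k) * (v $ j * v $ k) else 0"
  let ?L = "\<lambda>j k. if ?in j k then 0 else \<bar>B $$ (j, k)\<bar> * (v $ j)\<^sup>2"
  have row: "(\<Sum>k<n. lumped_precond i B $$ (j, k) * (v $ j * v $ k))
      = (\<Sum>k<n. ?D j k) + (\<Sum>k<n. ?L j k)" if j: "j < n" for j
  proof -
    let ?s = "\<Sum>l<n. if ?in j l then 0 else \<bar>B $$ (j, l)\<bar>"
    have "(\<Sum>k<n. lumped_precond i B $$ (j, k) * (v $ j * v $ k))
        = (\<Sum>k<n. ?D j k + (if k = j then ?s * (v $ j)\<^sup>2 else 0))"
      using j B by (intro sum.cong) (auto simp: lumped_precond_index algebra_simps power2_eq_square)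
    also have "\<dots> = (\<Sum>k<n. ?D j k) + ?s * (v $ j)\<^sup>2"
      using j by (simp add: sum.distrib)
    also have "?s * (v $ j)\<^sup>2 = (\<Sum>k<n. ?L j k)"
      unfolding sum_distrib_right by (intro sum.cong) auto
    finally show ?thesis .
  qed
  \<comment> \<open>The symmetry of \<open>B\<close> allows the lumped term to be charged to either index.\<close>
  have swap: "(\<Sum>j<n. \<Sum>k<n. ?L j k)
      = (\<Sum>j<n. \<Sum>k<n. if ?in j k then 0 else \<bar>B $$ (j, k)\<bar> * (v $ k)\<^sup>2)"
    by (subst sum.swap, intro sum.cong refl)
      (auto simp: abs_minus_commute symmetric_mat_index[OF B])
  have "v \<bullet> (lumped_precond i B *\<^sub>v v)
      = (\<Sum>j<n. \<Sum>k<n. ?D j k) + (\<Sum>j<n. \<Sum>k<n. ?L j k)"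
    unfolding quadratic_form_sum[OF lumped_precond_carrier[OF B(1)] v]
    by (simp add: row sum.distrib)
  \<comment> \<open>Average the two expressions for the lumped term.\<close>
  also have "(\<Sum>j<n. \<Sum>k<n. ?L j k) = ((\<Sum>j<n. \<Sum>k<n. ?L j k)
      + (\<Sum>j<n. \<Sum>k<n. if ?in j k then 0 else \<bar>B $$ (j, k)\<bar> * (v $ k)\<^sup>2)) / 2"
    using swap by simp
  also have "\<dots> = (\<Sum>j<n. \<Sum>k<n. if ?in j k then 0
      else \<bar>B $$ (j, k)\<bar> * (((v $ j)\<^sup>2 + (v $ k)\<^sup>2) / 2))"
    unfolding sum.distrib[symmetric] sum_divide_distrib
    by (intro sum.cong) (auto simp: field_simps)
  also have "(\<Sum>j<n. \<Sum>k<n. ?D j k) + \<dots> = (\<Sum>j<n. \<Sum>k<n.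
    if ?in j k then B $$ (j, k) * (v $ j * v $ k)
    else \<bar>B $$ (j, k)\<bar> * (((v $ j)\<^sup>2 + (v $ k)\<^sup>2) / 2))"
    unfolding sum.distrib[symmetric] by (intro sum.cong) auto
  finally show ?thesis .
qed

lemma mult_le_abs_mult_mean_squares:
  fixes b x y :: real
  shows "b * (x * y) \<le> \<bar>b\<bar> * ((x\<^sup>2 + y\<^sup>2) / 2)"
proof -
  have "\<bar>x * y\<bar> \<le> (x\<^sup>2 + y\<^sup>2) / 2"
    using sum_squares_bound[of "\<bar>x\<bar>" "\<bar>y\<bar>"] by (simp add: abs_mult)
  then have "\<bar>b\<bar> * \<bar>x * y\<bar> \<le> \<bar>b\<bar> * ((x\<^sup>2 + y\<^sup>2) / 2)" by (intro mult_left_mono) auto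
  then show ?thesis by (simp add: abs_mult[symmetric])
qed

lemma quadratic_form_le_lumped_precond:
  assumes B: "B \<in> carrier_mat n n" "symmetric_mat B" and v: "v \<in> carrier_vec n"
  shows "v \<bullet> (B *\<^sub>v v) \<le> v \<bullet> (lumped_precond i B *\<^sub>v v)"
  unfolding lumped_precond_quadratic_form[OF assms] quadratic_form_sum[OF B(1) v]
  by (intro sum_mono) (auto simp del: times_divide_eq_right intro: mult_le_abs_mult_mean_squares)

lemma lumped_precond_quadratic_form_antimono:
  assumes B: "B \<in> carrier_mat n n" "symmetric_mat B" and v: "v \<in> carrier_vec n" and "i \<le> i'"
  shows "v \<bullet> (lumped_precond i' B *\<^sub>v v) \<le> v \<bullet> (lumped_precond i B *\<^sub>v v)"
  unfolding lumped_precond_quadratic_form[OF assms(1-3)]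
  using \<open>i \<le> i'\<close> by (intro sum_mono) (auto simp del: times_divide_eq_right intro: mult_le_abs_mult_mean_squares)

lemma pos_def_lumped_precond:
  assumes B: "B \<in> carrier_mat n n" "symmetric_mat B" "pos_def_mat B"
  shows "pos_def_mat (lumped_precond i B)"
  using lumped_precond_carrier[OF B(1), of i] pos_def_matD[OF B(3,1)]
    quadratic_form_le_lumped_precond[OF B(1,2), of _ i]
  unfolding pos_def_mat_def by (auto intro: less_le_trans)

lemma gen_spectrum_lumped_precond:
  assumes B: "B \<in> carrier_mat n n" "symmetric_mat B" "pos_def_mat B"
  shows "gen_spectrum B (lumped_precond i B) \<subseteq> {0<..1}"
proof
  let ?P = "lumped_precond i B"
  note P = lumped_precond_carrier[OF B(1), of i]
  fix l assume "l \<in> gen_spectrum B ?P"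
  then have "det (B - l \<cdot>\<^sub>m ?P) = 0" by (simp add: gen_spectrum_def)
  moreover have carr: "B - l \<cdot>\<^sub>m ?P \<in> carrier_mat n n"
    using P by (intro minus_carrier_mat smult_carrier_mat)
  ultimately obtain v where v: "v \<in> carrier_vec n" "v \<noteq> 0\<^sub>v n" "(B - l \<cdot>\<^sub>m ?P) *\<^sub>v v = 0\<^sub>v n"
    using det_0_iff_vec_prod_zero_field by blast
  have "0 = v \<bullet> ((B - l \<cdot>\<^sub>m ?P) *\<^sub>v v)" using v by simp
  also have "\<dots> = v \<bullet> (B *\<^sub>v v) - l * (v \<bullet> (?P *\<^sub>v v))"
    unfolding quadratic_form_sum[OF carr v(1)] quadratic_form_sum[OF P v(1)]
      quadratic_form_sum[OF B(1) v(1)]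
    using P B(1) by (simp add: sum_distrib_left sum_subtractf left_diff_distrib mult.assoc)
  finally have eq: "v \<bullet> (B *\<^sub>v v) = l * (v \<bullet> (?P *\<^sub>v v))" by simp
  have pos: "0 < v \<bullet> (B *\<^sub>v v)" using pos_def_matD[OF B(3,1) v(1,2)] .
  have le: "v \<bullet> (B *\<^sub>v v) \<le> v \<bullet> (?P *\<^sub>v v)" using quadratic_form_le_lumped_precond[OF B(1,2) v(1)] .
  have "0 < l" using pos le eq by (metis less_le_trans zero_less_mult_pos2)
  moreover have "l * (v \<bullet> (?P *\<^sub>v v)) \<le> 1 * (v \<bullet> (?P *\<^sub>v v))" using eq le by simp
  then have "l \<le> 1" using pos le by (meson less_le_trans mult_right_le_imp_le)
  ultimately show "l \<in> {0<..1}" by simp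
qed

lemma one_in_gen_spectrum_lumped_precond:
  assumes B: "B \<in> carrier_mat n n" "nonneg_entries B" and n: "0 < n"
  shows "1 \<in> gen_spectrum B (lumped_precond i B)"
proof -
  let ?P = "lumped_precond i B"
  note P = lumped_precond_carrier[OF B(1), of i]
  \<comment> \<open>Lumping preserves the row sums of a nonnegative matrix.\<close>
  define u :: "real vec" where "u = vec n (\<lambda>_. 1)"
  have "u $ 0 \<noteq> 0\<^sub>v n $ 0" using n by (simp add: u_def)
  then have u: "u \<in> carrier_vec n" "u \<noteq> 0\<^sub>v n" by (auto simp: u_def)
  have nn: "B $$ (j, k) \<ge> 0" if "j < n" "k < n" for j k
    using B that by (auto simp: nonneg_entries_def)
  have "(B - 1 \<cdot>\<^sub>m ?P) *\<^sub>v u = 0\<^sub>v n"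
  proof (rule eq_vecI)
    fix j assume "j < dim_vec (0\<^sub>v n :: real vec)"
    then have j: "j < n" by simp
    let ?in = "\<lambda>k. \<bar>int j - int k\<bar> < int i"
    have "(\<Sum>k<n. ?P $$ (j, k)) = (\<Sum>k<n. if ?in k then B $$ (j, k) else 0)
        + (\<Sum>k<n. if ?in k then 0 else \<bar>B $$ (j, k)\<bar>)"
      using j by (simp add: lumped_precond_index[OF B(1)] sum.distrib)
    also have "\<dots> = (\<Sum>k<n. B $$ (j, k))"
      unfolding sum.distrib[symmetric] using nn[OF j] by (intro sum.cong) auto
    finally show "((B - 1 \<cdot>\<^sub>m ?P) *\<^sub>v u) $ j = 0\<^sub>v n $ j"
      using j B P by (simp add: u_def scalar_prod_def atLeast0LessThan sum_subtractf)
  qed (use P in simp)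
  moreover have "B - 1 \<cdot>\<^sub>m ?P \<in> carrier_mat n n"
    using P by (intro minus_carrier_mat smult_carrier_mat)
  ultimately show ?thesis
    using det_0_iff_vec_prod_zero_field u unfolding gen_spectrum_def by blast
qed

theorem theorem3p21:
  fixes B :: "real mat" and n :: nat
  assumes "B \<in> carrier_mat n n"
    and "symmetric_mat B"
    and "pos_def_mat B"
  shows "(\<forall>i \<in> {1..n}. gen_spectrum B (lumped_precond i B) \<subseteq> {0<..1}) \<and>
         (\<forall>i \<in> {1..n-1}. \<forall>k \<in> {1..n}.
            gen_eigenvalue k B (lumped_precond i B) \<le> gen_eigenvalue k B (lumped_precond (i + 1) B)) \<and>
         (nonneg_entries B \<longrightarrow>
            (\<forall>i \<in> {1..n}. gen_eigenvalue n B (lumped_precond i B) = 1))"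
proof (intro conjI ballI impI)
  fix i
  show "gen_spectrum B (lumped_precond i B) \<subseteq> {0<..1}"
    using gen_spectrum_lumped_precond[OF assms] .
next
  fix i k assume k: "k \<in> {1..n}"
  note P = lumped_precond_carrier[OF assms(1)] symmetric_lumped_precond[OF assms(1,2)]
    pos_def_lumped_precond[OF assms]
  show "gen_eigenvalue k B (lumped_precond i B) \<le> gen_eigenvalue k B (lumped_precond (i + 1) B)"
    by (rule gen_eigenvalue_antimono[OF assms P P _ k])
      (rule lumped_precond_quadratic_form_antimono[OF assms(1,2)], auto)
next
  fix i assume nonneg: "nonneg_entries B" and "i \<in> {1..n}"
  then have n: "0 < n" by simp
  let ?P = "lumped_precond i B"
  note P = lumped_precond_carrier[OF assms(1), of i] symmetric_lumped_precond[OF assms(1,2), of i]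
    pos_def_lumped_precond[OF assms, of i]
  obtain es where es: "sorted es" "length es = n" "gen_eigenvalue_mset B ?P = mset es"
    using simultaneous_diagonalization[OF assms(1,2) P] by blast
  then have set: "set es = gen_spectrum B ?P"
    using set_gen_eigenvalue_mset[OF assms(1) P(1) assms(2) P(2,3)] by simp
  have last: "es ! (n - 1) \<in> set es" using es(2) n by simp
  obtain j where j: "j < n" "es ! j = 1"
    using one_in_gen_spectrum_lumped_precond[OF assms(1) nonneg n, of i] es(2) set
    by (metis in_set_conv_nth)
  then have "1 \<le> es ! (n - 1)" using sorted_nth_mono[OF es(1), of j "n - 1"] es(2) by simp
  moreover have "es ! (n - 1) \<le> 1"
    using last set gen_spectrum_lumped_precond[OF assms, of i] by auto
  moreover have "gen_eigenvalue n B ?P = es ! (n - 1)"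
    using gen_eigenvalue_nth[OF es(3,1), of "n - 1"] n by simp
  ultimately show "gen_eigenvalue n B ?P = 1" by simp
qed

end
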